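(* Let $\alpha>0$, $\alpha\ne1$, and let $\mathbf{X}_1,\dots,\mathbf{X}_n$ be $n$ i.i.d. samples. Let $\Pi=\{p_\theta:\theta\in\Theta\}$ be one of the families $\mathbb{B}^{(\alpha)}$, $\mathbb{M}^{(\alpha)}$ or $\mathscr{E}^{(\alpha)}$ characterized by $h,w,f,\Theta,\mathbb{S}$, and assume that the support $\mathbb{S}$ of $\Pi$ does not depend on $\theta$. In (c), assume also that $\int\partial_r[p_\theta(\mathbf{x})]\,d\mathbf{x}=0$ for $r\in\{1,\dots,k\}$. Then the following hold. (a) The Basu et al. estimator under $\mathbb{B}^{(\alpha)}$ must satisfy $$\partial_r[w(\theta)]^\top\,\mathbb{E}_\theta[f(\mathbf{X})]=\partial_r[w(\theta)]^\top\bar f,\quad r\in\{1,\dots,k\}.$$ (b) The Jones et al. estimator under $\mathbb{M}^{(\alpha)}$ must satisfy $$\frac{\partial_r[w(\theta)]^\top\mathbb{E}_\theta[f(\mathbf{X})]}{\mathbb{E}_\theta[h(\mathbf{X})+w(\theta)^\top f(\mathbf{X})]}=\frac{\partial_r[w(\theta)]^\top\bar f}{\bar h+w(\theta)^\top\bar f},\quad r\in\{1,\dots,k\}.$$ (c) The generalized Hellinger estimator under $\mathscr{E}^{(\alpha)}$ must satisfy $$\frac{\partial_r[w(\theta)]^\top\mathbb{E}_{\theta^{(\alpha)}}[f(\mathbf{X})]}{\mathbb{E}_{\theta^{(\alpha)}}[h(\mathbf{X})+w(\theta)^\top f(\mathbf{X})]}=\frac{\partial_r[w(\theta)]^\top\overline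 f^{(\alpha)}}{\overline h^{(\alpha)}+w(\theta)^\top\overline f^{(\alpha)}},\quad r\in\{1,\dots,k\}.$$ Here $\partial_r[w(\theta)]=\big[\tfrac{\partial}{\partial\theta_r}w_1(\theta),\dots,\tfrac{\partial}{\partial\theta_r}w_s(\theta)\big]^\top$.
   Context: Integrals are over $\mathbb{S}\subseteq\mathbb{R}^d$ with respect to Lebesgue measure (continuous case) or counting measure (discrete case); all integrals are assumed well defined (finite), and the sample points lie in $\mathbb{S}$. $\partial_r=\partial/\partial\theta_r$, $\nabla$ is the gradient in $\theta$, and $s(\mathbf{x};\theta)=\nabla\ln p_\theta(\mathbf{x})$. Families: let $\Theta\subset\mathbb{R}^k$ be open, $w=[w_1,\dots,w_s]^\top$ with $w_i:\Theta\to\mathbb{R}$ differentiable, $f=[f_1,\dots,f_s]^\top$, $f_i:\mathbb{R}^d\to\mathbb{R}$, $h:\mathbb{R}^d\to\mathbb{R}$. For $\mathbf{x}\in\mathbb{S}$ (and $p_\theta=0$ off $\mathbb{S}$): - $\mathbb{B}^{(\alpha)}$: $p_\theta(\mathbf{x})=[h(\mathbf{x})+F(\theta)+w(\theta)^\top f(\mathbf{x})]^{1/(\alpha-1)}$; - $\mathbb{M}^{(\alpha)}$: $p_\theta(\mathbf{x})=Z(\theta)[h(\mathbf{x})+w(\theta)^\top f(\mathbf{x})]^{1/(\alpha-1)}$; - $\mathscr{E}^{(\alpha)}$: $p_\theta(\mathbf{x})=Z(\theta)[h(\mathbf{x})+w(\theta)^\top f(\mathbf{x})]^{1/(1-\alpha)}$,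 with $F,Z:\Theta\to\mathbb{R}$ differentiable normalizing functions. Estimators are the values $\theta\in\Theta$ solving the respective estimating equations: - Basu et al.: $\frac1n\sum_{j=1}^n p_\theta(\mathbf{X}_j)^{\alpha-1}s(\mathbf{X}_j;\theta)=\int p_\theta(\mathbf{x})^\alpha s(\mathbf{x};\theta)\,d\mathbf{x}$; - Jones et al.: $\dfrac{\frac1n\sum_j p_\theta(\mathbf{X}_j)^{\alpha-1}s(\mathbf{X}_j;\theta)}{\frac1n\sum_j p_\theta(\mathbf{X}_j)^{\alpha-1}}=\dfrac{\int p_\theta^\alpha s(\cdot;\theta)}{\int p_\theta^\alpha}$; - generalized Hellinger: $\int\widetilde p_n(\mathbf{x})^\alpha p_\theta(\mathbf{x})^{1-\alpha}s(\mathbf{x};\theta)\,d\mathbf{x}=0$, where $\widetilde p_n$ is the empirical distribution $p_n$ of the sample in the discrete case and a suitable continuous (density) estimate of $p_n$ on $\mathbb{S}$ in the continuous case. Notation: $\mathbb{E}_\theta$ is expectation under $p_\theta$; $\bar f=\frac1n\sum_j f(\mathbf{X}_j)$, $\bar h=\frac1n\sum_j h(\mathbf{X}_j)$; for a density $p$, $p^{(\alpha)}=p^\alpha/\int p^\alpha$; $\mathbb{E}_{\theta^{(\alpha)}}$ is expectation under $p_\theta^{(\alpha)}$; $\overline h^{(\alpha)}$ and $\overline f^{(\alpha)}$ are the expectations of $h$ and $f$ under $\widetilde p_n^{(\alpha)}$. *)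

theory Defs
  imports "HOL-Probability.Probability"
begin

datatype setting = Continuous | Discrete

primrec ref_measure :: "setting \<Rightarrow> (real^'d) set \<Rightarrow> (real^'d) measure" where
  "ref_measure Continuous S = lebesgue_on S"
| "ref_measure Discrete S = count_space S"

definition is_density :: "(real^'d) measure \<Rightarrow> (real^'d) set \<Rightarrow> (real^'d \<Rightarrow> real) \<Rightarrow> bool" where
  "is_density \<mu> S q \<longleftrightarrow>
     (\<forall>x. 0 \<le> q x) \<and> (\<forall>x. x \<notin> S \<longrightarrow> q x = 0) \<and> has_bochner_integral \<mu> q 1"

definition partial_deriv :: "'k::finite \<Rightarrow> (real^'k \<Rightarrow> real) \<Rightarrow> real^'k \<Rightarrow> real" where
  "partial_deriv r g \<theta> = deriv (\<lambda>t. g (\<theta> + t *\<^sub>R axis r 1)) 0"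

definition grad :: "(real^'k::finite \<Rightarrow> real) \<Rightarrow> real^'k \<Rightarrow> real^'k" where
  "grad g \<theta> = (\<chi> r. partial_deriv r g \<theta>)"

definition partial_deriv_vec :: "'k::finite \<Rightarrow> (real^'k \<Rightarrow> real^'s) \<Rightarrow> real^'k \<Rightarrow> real^'s" where
  "partial_deriv_vec r w \<theta> = (\<chi> i. partial_deriv r (\<lambda>t. w t $ i) \<theta>)"

definition score :: "(real^'k::finite \<Rightarrow> real^'d \<Rightarrow> real) \<Rightarrow> real^'k \<Rightarrow> real^'d \<Rightarrow> real^'k" where
  "score p \<theta> x = grad (\<lambda>t. ln (p t x)) \<theta>"

text \<open>In the three families below, the base of the real power is required to be nonnegative on
  \<open>S\<close>, since \<open>powr\<close> is a totalised function whose values at negative bases are meaningless.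
  The normalizing function is bound existentially: it is determined by the other data.\<close>

definition B_family :: "real \<Rightarrow> (real^'d) measure \<Rightarrow> (real^'d) set \<Rightarrow> (real^'k::finite) set \<Rightarrow>
    (real^'d \<Rightarrow> real) \<Rightarrow> (real^'k \<Rightarrow> real^'s) \<Rightarrow> (real^'d \<Rightarrow> real^'s) \<Rightarrow>
    (real^'k \<Rightarrow> real^'d \<Rightarrow> real) \<Rightarrow> bool" where
  "B_family \<alpha> \<mu> S \<Theta> h w f p \<longleftrightarrow>
     open \<Theta> \<and> (\<forall>i. (\<lambda>\<theta>. w \<theta> $ i) differentiable_on \<Theta>) \<and>
     (\<forall>\<theta>\<in>\<Theta>. is_density \<mu> S (p \<theta>)) \<and>
     (\<exists>F. F differentiable_on \<Theta> \<and>
       (\<forall>\<theta>\<in>\<Theta>. \<forall>x\<in>S. 0 \<le> h x + F \<theta> + w \<theta> \<bullet> f x \<and>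
          p \<theta> x = (h x + F \<theta> + w \<theta> \<bullet> f x) powr (1 / (\<alpha> - 1))))"

definition M_family :: "real \<Rightarrow> (real^'d) measure \<Rightarrow> (real^'d) set \<Rightarrow> (real^'k::finite) set \<Rightarrow>
    (real^'d \<Rightarrow> real) \<Rightarrow> (real^'k \<Rightarrow> real^'s) \<Rightarrow> (real^'d \<Rightarrow> real^'s) \<Rightarrow>
    (real^'k \<Rightarrow> real^'d \<Rightarrow> real) \<Rightarrow> bool" where
  "M_family \<alpha> \<mu> S \<Theta> h w f p \<longleftrightarrow>
     open \<Theta> \<and> (\<forall>i. (\<lambda>\<theta>. w \<theta> $ i) differentiable_on \<Theta>) \<and>
     (\<forall>\<theta>\<in>\<Theta>. is_density \<mu> S (p \<theta>)) \<and>
     (\<exists>Z :: real^'k \<Rightarrow> real. Z differentiable_on \<Theta> \<and>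
       (\<forall>\<theta>\<in>\<Theta>. \<forall>x\<in>S. 0 \<le> h x + w \<theta> \<bullet> f x \<and>
          p \<theta> x = Z \<theta> * (h x + w \<theta> \<bullet> f x) powr (1 / (\<alpha> - 1))))"

definition E_family :: "real \<Rightarrow> (real^'d) measure \<Rightarrow> (real^'d) set \<Rightarrow> (real^'k::finite) set \<Rightarrow>
    (real^'d \<Rightarrow> real) \<Rightarrow> (real^'k \<Rightarrow> real^'s) \<Rightarrow> (real^'d \<Rightarrow> real^'s) \<Rightarrow>
    (real^'k \<Rightarrow> real^'d \<Rightarrow> real) \<Rightarrow> bool" where
  "E_family \<alpha> \<mu> S \<Theta> h w f p \<longleftrightarrow>
     open \<Theta> \<and> (\<forall>i. (\<lambda>\<theta>. w \<theta> $ i) differentiable_on \<Theta>) \<and>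
     (\<forall>\<theta>\<in>\<Theta>. is_density \<mu> S (p \<theta>)) \<and>
     (\<exists>Z :: real^'k \<Rightarrow> real. Z differentiable_on \<Theta> \<and>
       (\<forall>\<theta>\<in>\<Theta>. \<forall>x\<in>S. 0 \<le> h x + w \<theta> \<bullet> f x \<and>
          p \<theta> x = Z \<theta> * (h x + w \<theta> \<bullet> f x) powr (1 / (1 - \<alpha>))))"

definition expect :: "(real^'d) measure \<Rightarrow> (real^'d \<Rightarrow> real) \<Rightarrow>
    (real^'d \<Rightarrow> 'v::{banach, second_countable_topology}) \<Rightarrow> 'v" where
  "expect \<mu> q g = (\<integral>x. q x *\<^sub>R g x \<partial>\<mu>)"

definition escort :: "(real^'d) measure \<Rightarrow> real \<Rightarrow> (real^'d \<Rightarrow> real) \<Rightarrow> real^'d \<Rightarrow> real" where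
  "escort \<mu> \<alpha> q x = q x powr \<alpha> / (\<integral>y. q y powr \<alpha> \<partial>\<mu>)"

definition sample_mean :: "nat \<Rightarrow> (nat \<Rightarrow> real^'d) \<Rightarrow> (real^'d \<Rightarrow> 'v::real_vector) \<Rightarrow> 'v" where
  "sample_mean n xs g = (1 / real n) *\<^sub>R (\<Sum>j=1..n. g (xs j))"

definition empirical :: "nat \<Rightarrow> (nat \<Rightarrow> real^'d) \<Rightarrow> real^'d \<Rightarrow> real" where
  "empirical n xs x = real (card {j \<in> {1..n}. xs j = x}) / real n"

text \<open>No particular smoothing method is fixed in the continuous case: any density on \<open>S\<close>
  is admitted as the estimate.\<close>

primrec sample_estimate :: "setting \<Rightarrow> (real^'d) set \<Rightarrow> nat \<Rightarrow> (nat \<Rightarrow> real^'d) \<Rightarrow>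
    (real^'d \<Rightarrow> real) \<Rightarrow> bool" where
  "sample_estimate Continuous S n xs q \<longleftrightarrow> is_density (ref_measure Continuous S) S q"
| "sample_estimate Discrete S n xs q \<longleftrightarrow> q = empirical n xs"

definition basu_estimator :: "real \<Rightarrow> (real^'d) measure \<Rightarrow> (real^'k::finite) set \<Rightarrow>
    (real^'k \<Rightarrow> real^'d \<Rightarrow> real) \<Rightarrow> nat \<Rightarrow> (nat \<Rightarrow> real^'d) \<Rightarrow> real^'k \<Rightarrow> bool" where
  "basu_estimator \<alpha> \<mu> \<Theta> p n xs \<theta> \<longleftrightarrow> \<theta> \<in> \<Theta> \<and>
     sample_mean n xs (\<lambda>x. p \<theta> x powr (\<alpha> - 1) *\<^sub>R score p \<theta> x) =
       (\<integral>x. p \<theta> x powr \<alpha> *\<^sub>R score p \<theta> x \<partial>\<mu>)"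

definition jones_estimator :: "real \<Rightarrow> (real^'d) measure \<Rightarrow> (real^'k::finite) set \<Rightarrow>
    (real^'k \<Rightarrow> real^'d \<Rightarrow> real) \<Rightarrow> nat \<Rightarrow> (nat \<Rightarrow> real^'d) \<Rightarrow> real^'k \<Rightarrow> bool" where
  "jones_estimator \<alpha> \<mu> \<Theta> p n xs \<theta> \<longleftrightarrow> \<theta> \<in> \<Theta> \<and>
     sample_mean n xs (\<lambda>x. p \<theta> x powr (\<alpha> - 1) *\<^sub>R score p \<theta> x)
         /\<^sub>R sample_mean n xs (\<lambda>x. p \<theta> x powr (\<alpha> - 1)) =
       (\<integral>x. p \<theta> x powr \<alpha> *\<^sub>R score p \<theta> x \<partial>\<mu>) /\<^sub>R (\<integral>x. p \<theta> x powr \<alpha> \<partial>\<mu>)"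

definition hellinger_estimator :: "real \<Rightarrow> (real^'d) measure \<Rightarrow> (real^'k::finite) set \<Rightarrow>
    (real^'k \<Rightarrow> real^'d \<Rightarrow> real) \<Rightarrow> (real^'d \<Rightarrow> real) \<Rightarrow> real^'k \<Rightarrow> bool" where
  "hellinger_estimator \<alpha> \<mu> \<Theta> p q \<theta> \<longleftrightarrow> \<theta> \<in> \<Theta> \<and>
     (\<integral>x. (q x powr \<alpha> * p \<theta> x powr (1 - \<alpha>)) *\<^sub>R score p \<theta> x \<partial>\<mu>) = 0"

definition iid :: "'o measure \<Rightarrow> nat \<Rightarrow> (nat \<Rightarrow> 'o \<Rightarrow> real^'d) \<Rightarrow> bool" where
  "iid P n X \<longleftrightarrow> prob_space P \<and> prob_space.indep_vars P (\<lambda>_. borel) X {1..n} \<and>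
     (\<forall>i\<in>{1..n}. \<forall>j\<in>{1..n}. distr P borel (X i) = distr P borel (X j))"

end

theory Submission
  imports Defs
begin

text \<open>In each family a suitable power of \<open>p\<^sub>\<theta>\<close> cancels the denominator of the score, so that the
  integrand of the estimating equation becomes affine in \<open>f\<close> (and \<open>h\<close>).  The unknown logarithmic
  derivative of the normalizing function enters both sides in the same way: it cancels in (a)
  and (b), and in (c) it is eliminated against the identity \<open>\<integral>\<partial>\<^sub>r p\<^sub>\<theta> = 0\<close>, whose integrand
  is affine in \<open>f\<close> and \<open>h\<close> with weight \<open>p\<^sub>\<theta>\<^sup>\<alpha>\<close>.\<close>

section \<open>Partial derivatives along coordinate lines and the score of a power family\<close>

lemma has_real_derivative_partial_deriv:
  assumes "g differentiable (at \<theta>)"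
  shows "((\<lambda>t. g (\<theta> + t *\<^sub>R axis r 1)) has_real_derivative partial_deriv r g \<theta>) (at 0)"
proof -
  have "(\<lambda>t. \<theta> + t *\<^sub>R axis r (1::real)) differentiable (at 0)"
    by (intro derivative_intros)
  then have "(g \<circ> (\<lambda>t. \<theta> + t *\<^sub>R axis r (1::real))) differentiable (at 0)"
    using assms by (intro differentiable_chain_at) auto
  then show ?thesis
    unfolding partial_deriv_def by (simp add: DERIV_deriv_iff_real_differentiable o_def)
qed

lemma partial_deriv_eqI:
  assumes "((\<lambda>t. g (\<theta> + t *\<^sub>R axis r 1)) has_real_derivative D) (at 0)"
  shows "partial_deriv r g \<theta> = D"
  unfolding partial_deriv_def using assms by (rule DERIV_imp_deriv)

text \<open>The formula for \<open>p\<close> is known only for parameters in \<Theta>. Openness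
  keeps the coordinate line through \<theta> inside \<Theta> for small \<open>t\<close>, and
  \<open>deriv\<close> depends only on values near 0.\<close>

lemma partial_deriv_cong_open:
  assumes "open T" "\<theta> \<in> T" "\<And>t. t \<in> T \<Longrightarrow> g t = g' t"
  shows "partial_deriv r g \<theta> = partial_deriv r g' \<theta>"
proof -
  have "((\<lambda>t. \<theta> + t *\<^sub>R axis r (1::real)) \<longlongrightarrow> \<theta> + 0 *\<^sub>R axis r 1) (nhds 0)"
    by (intro tendsto_intros filterlim_ident)
  then have "\<forall>\<^sub>F t in nhds 0. \<theta> + t *\<^sub>R axis r (1::real) \<in> T"
    using assms(1,2) by (intro topological_tendstoD) auto
  then have "\<forall>\<^sub>F t in nhds 0. g (\<theta> + t *\<^sub>R axis r 1) = g' (\<theta> + t *\<^sub>R axis r 1)"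
    by eventually_elim (simp add: assms(3))
  then show ?thesis
    unfolding partial_deriv_def by (intro deriv_cong_ev) auto
qed

lemma partial_deriv_inner_left:
  fixes w :: "real^'k::finite \<Rightarrow> real^'s"
  assumes "F differentiable (at \<theta>)" "\<And>i. (\<lambda>t. w t $ i) differentiable (at \<theta>)"
  shows "partial_deriv r (\<lambda>t. a + F t + w t \<bullet> v) \<theta> = partial_deriv r F \<theta> + partial_deriv_vec r w \<theta> \<bullet> v"
proof (rule partial_deriv_eqI)
  note D = has_real_derivative_partial_deriv[OF assms(1), of r]
    has_real_derivative_partial_deriv[OF assms(2), of r]
  show "((\<lambda>t. a + F (\<theta> + t *\<^sub>R axis r 1) + w (\<theta> + t *\<^sub>R axis r 1) \<bullet> v) has_real_derivative
      partial_deriv r F \<theta> + partial_deriv_vec r w \<theta> \<bullet> v) (at 0)"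
    unfolding inner_vec_def partial_deriv_vec_def
    by (auto intro!: derivative_eq_intros D sum.cong)
qed

text \<open>Logarithmic differentiation. The derivative of the product is written as its value times
  the logarithmic derivative, so that the chain rule for \<open>ln\<close> cancels the value and
  leaves the second formula. Positivity keeps \<open>powr\<close> and \<open>ln\<close> in the range
  where they are differentiable.\<close>

lemma partial_deriv_scaled_powr:
  assumes Z: "Z differentiable (at \<theta>)" and b: "b differentiable (at \<theta>)"
    and pos: "0 < Z \<theta>" "0 < b \<theta>"
  shows "partial_deriv r (\<lambda>t. Z t * b t powr c) \<theta> =
      Z \<theta> * b \<theta> powr c * (partial_deriv r Z \<theta> / Z \<theta> + c * (partial_deriv r b \<theta> / b \<theta>))"
    and "partial_deriv r (\<lambda>t. ln (Z t * b t powr c)) \<theta> =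
      partial_deriv r Z \<theta> / Z \<theta> + c * (partial_deriv r b \<theta> / b \<theta>)"
proof -
  let ?l = "\<lambda>t. \<theta> + t *\<^sub>R axis r (1::real)"
  let ?A = "partial_deriv r Z \<theta> / Z \<theta> + c * (partial_deriv r b \<theta> / b \<theta>)"
  note DZ = has_real_derivative_partial_deriv[OF Z, of r]
    and Db = has_real_derivative_partial_deriv[OF b, of r]
  have "((\<lambda>t. b (?l t) powr c) has_real_derivative
      c * b \<theta> powr (c - 1) * partial_deriv r b \<theta>) (at 0)"
    using DERIV_fun_powr[OF Db, of c] pos by simp
  from DERIV_mult[OF DZ this]
  have D: "((\<lambda>t. Z (?l t) * b (?l t) powr c) has_real_derivative Z \<theta> * b \<theta> powr c * ?A) (at 0)"
    by (rule DERIV_cong) (use pos in \<open>simp add: powr_diff field_simps\<close>)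
  then show "partial_deriv r (\<lambda>t. Z t * b t powr c) \<theta> = Z \<theta> * b \<theta> powr c * ?A"
    by (rule partial_deriv_eqI)
  have "((\<lambda>t. ln (Z (?l t) * b (?l t) powr c)) has_real_derivative
      1 / (Z \<theta> * b \<theta> powr c) * (Z \<theta> * b \<theta> powr c * ?A)) (at 0)"
    using DERIV_chain2[OF DERIV_ln_divide D] pos by simp
  then show "partial_deriv r (\<lambda>t. ln (Z t * b t powr c)) \<theta> = ?A"
    using pos by (intro partial_deriv_eqI) simp
qed

text \<open>One shape covers all three families at a fixed point \<open>x\<close>:
  \<open>Z = 1\<close> gives the B-family, \<open>F = 0\<close> gives the M- and E-families, and
  only the exponent \<open>c\<close> changes.\<close>

lemma power_family_derivs:
  fixes w :: "real^'k::finite \<Rightarrow> real^'s" and p :: "real^'k \<Rightarrow> real^'d \<Rightarrow> real"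
  assumes "open \<Theta>" "\<theta> \<in> \<Theta>" and w: "\<And>i. (\<lambda>\<theta>. w \<theta> $ i) differentiable_on \<Theta>"
    and F: "F differentiable_on \<Theta>" and Z: "Z differentiable_on \<Theta>"
    and base: "\<And>t. t \<in> \<Theta> \<Longrightarrow> 0 \<le> h x + F t + w t \<bullet> f x"
    and p: "\<And>t. t \<in> \<Theta> \<Longrightarrow> p t x = Z t * (h x + F t + w t \<bullet> f x) powr c"
    and p_pos: "p \<theta> x > 0"
  defines "b \<equiv> h x + F \<theta> + w \<theta> \<bullet> f x"
  shows "0 < Z \<theta>" and "0 < b"
    and "score p \<theta> x $ r = partial_deriv r Z \<theta> / Z \<theta> +
      c * ((partial_deriv r F \<theta> + partial_deriv_vec r w \<theta> \<bullet> f x) / b)"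
    and "partial_deriv r (\<lambda>t. p t x) \<theta> = p \<theta> x * score p \<theta> x $ r"
proof -
  have b0: "0 \<le> b" using base[OF assms(2)] by (simp add: b_def)
  have pe: "p \<theta> x = Z \<theta> * b powr c" using p[OF assms(2)] by (simp add: b_def)
  \<comment> \<open>Since \<open>0 powr c = 0\<close> for every \<open>c\<close>, a vanishing base
    would make the density vanish at \<open>x\<close>; this upgrades the nonnegativity in the family
    to strict positivity.\<close>
  show b_pos: "0 < b" using b0 pe p_pos by (cases "b = 0") auto
  \<comment> \<open>The families impose no sign on \<open>Z\<close>; it is forced by
    \<open>p \<theta> x > 0\<close> and the positive power of the base.\<close>
  show Z_pos: "0 < Z \<theta>" using pe p_pos b_pos by (simp add: zero_less_mult_iff)
  have at: "g differentiable (at \<theta>)" if "g differentiable_on \<Theta>" for g :: "real^'k \<Rightarrow> real"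
    using that assms(1,2) by (meson differentiable_on_eq_differentiable_at)
  let ?b = "\<lambda>t. h x + F t + w t \<bullet> f x"
  have "?b differentiable (at \<theta>)"
    unfolding inner_vec_def using at[OF F] at[OF w]
    by (intro derivative_intros) (auto simp: inner_real_def)
  note D = partial_deriv_scaled_powr[OF at[OF Z] this Z_pos b_pos[unfolded b_def], of r c]
  have Db: "partial_deriv r ?b \<theta> = partial_deriv r F \<theta> + partial_deriv_vec r w \<theta> \<bullet> f x"
    using at[OF F] at[OF w] by (rule partial_deriv_inner_left)
  have "score p \<theta> x $ r = partial_deriv r (\<lambda>t. ln (Z t * ?b t powr c)) \<theta>"
    unfolding score_def grad_def using assms(1,2) p
    by (auto intro!: partial_deriv_cong_open)
  then show s: "score p \<theta> x $ r = partial_deriv r Z \<theta> / Z \<theta> +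
      c * ((partial_deriv r F \<theta> + partial_deriv_vec r w \<theta> \<bullet> f x) / b)"
    using D(2) by (simp add: Db b_def)
  have "partial_deriv r (\<lambda>t. p t x) \<theta> = partial_deriv r (\<lambda>t. Z t * ?b t powr c) \<theta>"
    using assms(1,2) p by (auto intro!: partial_deriv_cong_open)
  then show "partial_deriv r (\<lambda>t. p t x) \<theta> = p \<theta> x * score p \<theta> x $ r"
    using D(1) by (simp add: Db pe s b_def)
qed

section \<open>Linearity and positivity of integrals and sample means\<close>

lemma integral_vec_nth:
  fixes g :: "'a \<Rightarrow> real^'k::finite"
  assumes "integrable M g"
  shows "integral\<^sup>L M g $ r = (\<integral>x. g x $ r \<partial>M)"
  using integral_bounded_linear[OF bounded_linear_vec_nth assms, of r] by simp

lemma integral_inner_weighted: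
  fixes f :: "'a \<Rightarrow> real^'s::finite"
  assumes "integrable M (\<lambda>x. a x *\<^sub>R f x)"
  shows "integrable M (\<lambda>x. a x * (v \<bullet> f x))"
    and "(\<integral>x. a x * (v \<bullet> f x) \<partial>M) = v \<bullet> (\<integral>x. a x *\<^sub>R f x \<partial>M)"
  using integrable_inner_right[of v, OF assms] integral_inner_right[of v, OF assms] by simp_all

text \<open>A nonnegative integrable function with integral 0 vanishes almost everywhere. This
  supplies the positive denominators in the quotients for Jones and Hellinger.\<close>

lemma integral_pos_of_AE:
  fixes g :: "'a \<Rightarrow> real"
  assumes "integrable M g" "\<And>x. x \<in> space M \<Longrightarrow> 0 \<le> g x" "\<not> (AE x in M. g x = 0)"
  shows "0 < (\<integral>x. g x \<partial>M)"
proof -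
  have "AE x in M. 0 \<le> g x" using assms(2) by auto
  then show ?thesis
    using integral_nonneg_eq_0_iff_AE[OF assms(1)] integral_nonneg_AE[of g M] assms(3) by force
qed

lemma sample_mean_cong:
  assumes "\<And>j. j \<in> {1..n} \<Longrightarrow> g (xs j) = g' (xs j)"
  shows "sample_mean n xs g = sample_mean n xs g'"
  unfolding sample_mean_def using assms by (auto intro!: sum.cong)

lemma sample_mean_vec_nth: "sample_mean n xs g $ r = sample_mean n xs (\<lambda>x. g x $ r)"
  unfolding sample_mean_def by simp

lemma sample_mean_add: "sample_mean n xs (\<lambda>x. g x + g' x) = sample_mean n xs g + sample_mean n xs g'"
  unfolding sample_mean_def by (simp add: sum.distrib scaleR_add_right)

lemma sample_mean_mult_left:
  "sample_mean n xs (\<lambda>x. a * g x) = a * sample_mean n xs g" for a :: real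
  unfolding sample_mean_def by (simp add: sum_distrib_left)

lemma sample_mean_inner: "sample_mean n xs (\<lambda>x. v \<bullet> g x) = v \<bullet> sample_mean n xs g"
  unfolding sample_mean_def by (simp add: inner_sum_right)

lemma sample_mean_const: "n \<ge> 1 \<Longrightarrow> sample_mean n xs (\<lambda>x. a) = a" for a :: real
  unfolding sample_mean_def by simp

lemma sample_mean_pos:
  fixes g :: "real^'d \<Rightarrow> real"
  assumes "n \<ge> 1" "\<And>j. j \<in> {1..n} \<Longrightarrow> 0 < g (xs j)"
  shows "0 < sample_mean n xs g"
proof -
  have "0 < (\<Sum>j=1..n. g (xs j))"
    using assms by (intro sum_pos) auto
  then show ?thesis
    unfolding sample_mean_def using assms(1) by simp
qed

section \<open>The estimating equations for the three families\<close>

lemma is_density_AE_nonzero: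
  assumes "is_density \<mu> S q"
  shows "\<not> (AE x in \<mu>. q x = 0)"
  using assms integral_eq_zero_AE[of q \<mu>]
  by (auto simp: is_density_def has_bochner_integral_iff)

text \<open>Both sides of the \<open>r\<close>-th equation are averages of the same affine
  expression \<open>c * (?F + ?v \<bullet> f x)\<close>, one over the sample and one under
  \<open>p \<theta>\<close>. Both averages have total mass one, so \<open>?F\<close> enters both
  sides equally and cancels.\<close>

lemma basu_B_family:
  fixes w :: "real^'k::finite \<Rightarrow> real^'s" and p :: "real^'k \<Rightarrow> real^'d \<Rightarrow> real"
  assumes fam: "B_family \<alpha> \<mu> S \<Theta> h w f p" and est: "basu_estimator \<alpha> \<mu> \<Theta> p n xs \<theta>"
    and space: "space \<mu> = S" and "\<alpha> \<noteq> 1" "n \<ge> 1" and xs: "\<And>j. j \<in> {1..n} \<Longrightarrow> xs j \<in> S"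
    and pos: "\<And>t x. t \<in> \<Theta> \<Longrightarrow> x \<in> S \<Longrightarrow> p t x > 0"
    and int_score: "integrable \<mu> (\<lambda>x. p \<theta> x powr \<alpha> *\<^sub>R score p \<theta> x)"
    and int_f: "integrable \<mu> (\<lambda>x. p \<theta> x *\<^sub>R f x)"
  shows "partial_deriv_vec r w \<theta> \<bullet> expect \<mu> (p \<theta>) f = partial_deriv_vec r w \<theta> \<bullet> sample_mean n xs f"
proof -
  define c where "c = 1 / (\<alpha> - 1)"
  have c0: "c \<noteq> 0" and c: "c * (\<alpha> - 1) = 1" using \<open>\<alpha> \<noteq> 1\<close> by (auto simp: c_def)
  obtain F where F: "F differentiable_on \<Theta>"
    and base: "\<And>t x. t \<in> \<Theta> \<Longrightarrow> x \<in> S \<Longrightarrow> 0 \<le> h x + F t + w t \<bullet> f x"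
    and pF: "\<And>t x. t \<in> \<Theta> \<Longrightarrow> x \<in> S \<Longrightarrow> p t x = (h x + F t + w t \<bullet> f x) powr c"
    using fam unfolding B_family_def c_def by blast
  have \<Theta>: "open \<Theta>" "\<theta> \<in> \<Theta>" and w: "\<And>i. (\<lambda>\<theta>. w \<theta> $ i) differentiable_on \<Theta>"
    and dens: "has_bochner_integral \<mu> (p \<theta>) 1"
    and eq: "sample_mean n xs (\<lambda>x. p \<theta> x powr (\<alpha> - 1) *\<^sub>R score p \<theta> x) =
       (\<integral>x. p \<theta> x powr \<alpha> *\<^sub>R score p \<theta> x \<partial>\<mu>)"
    using fam est unfolding B_family_def basu_estimator_def is_density_def by auto
  let ?v = "partial_deriv_vec r w \<theta>" and ?F = "partial_deriv r F \<theta>"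
  have s1: "p \<theta> x powr (\<alpha> - 1) * score p \<theta> x $ r = c * (?F + ?v \<bullet> f x)" if x: "x \<in> S" for x
  proof -
    note D = power_family_derivs[where Z = "\<lambda>_. 1" and F = F and h = h and f = f and c = c and p = p
        and x = x, OF \<Theta> w F _ base[OF _ x] _ pos[OF \<Theta>(2) x]]
    \<comment> \<open>With \<open>Z = 1\<close> the term coming from the normalizing factor drops
      out of the score.\<close>
    have one: "partial_deriv r (\<lambda>_. 1) \<theta> = 0"
      by (rule partial_deriv_eqI) simp
    have b: "0 < h x + F \<theta> + w \<theta> \<bullet> f x"
      using D(2) pF x by simp
    have "p \<theta> x powr (\<alpha> - 1) = h x + F \<theta> + w \<theta> \<bullet> f x"
      using b by (simp add: pF[OF \<Theta>(2) x] powr_powr c)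
    moreover have "score p \<theta> x $ r = c * ((?F + ?v \<bullet> f x) / (h x + F \<theta> + w \<theta> \<bullet> f x))"
      using D(3)[of r] pF x one by simp
    ultimately show ?thesis using b by simp
  qed
  \<comment> \<open>One more factor \<open>p \<theta> x\<close> turns the sample integrand into the
    population integrand.\<close>
  have s2: "p \<theta> x powr \<alpha> * score p \<theta> x $ r = c * (?F * p \<theta> x + p \<theta> x * (?v \<bullet> f x))"
    if x: "x \<in> S" for x
  proof -
    have "p \<theta> x powr \<alpha> = p \<theta> x * p \<theta> x powr (\<alpha> - 1)"
      using pos[OF \<Theta>(2) x] by (simp add: powr_diff)
    then show ?thesis using s1[OF x] by (simp add: algebra_simps)
  qed
  have "sample_mean n xs (\<lambda>x. p \<theta> x powr (\<alpha> - 1) *\<^sub>R score p \<theta> x) $ r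
      = sample_mean n xs (\<lambda>x. c * (?F + ?v \<bullet> f x))"
    unfolding sample_mean_vec_nth using s1 xs by (intro sample_mean_cong) simp
  also have "\<dots> = c * (?F + ?v \<bullet> sample_mean n xs f)"
    using \<open>n \<ge> 1\<close>
    by (simp only: sample_mean_mult_left sample_mean_add sample_mean_inner sample_mean_const)
  finally have L: "sample_mean n xs (\<lambda>x. p \<theta> x powr (\<alpha> - 1) *\<^sub>R score p \<theta> x) $ r
      = c * (?F + ?v \<bullet> sample_mean n xs f)" .
  have "(\<integral>x. p \<theta> x powr \<alpha> *\<^sub>R score p \<theta> x \<partial>\<mu>) $ r
      = (\<integral>x. c * (?F * p \<theta> x + p \<theta> x * (?v \<bullet> f x)) \<partial>\<mu>)"
    unfolding integral_vec_nth[OF int_score] using s2 space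
    by (intro Bochner_Integration.integral_cong) auto
  also have "\<dots> = c * (?F + ?v \<bullet> expect \<mu> (p \<theta>) f)"
    using dens integral_inner_weighted[OF int_f, of ?v]
    by (simp add: has_bochner_integral_iff expect_def)
  finally show ?thesis using L c0 eq by simp
qed

text \<open>After division each side has the form
  \<open>A + c * (average of ?v \<bullet> f) / (average of the base)\<close>, with the sample
  average on one side and the \<open>p \<theta>\<close> average on the other. The factor
  \<open>k\<close> cancels within each quotient, and \<open>A\<close> cancels between the two
  sides.\<close>

lemma jones_M_family:
  fixes w :: "real^'k::finite \<Rightarrow> real^'s" and p :: "real^'k \<Rightarrow> real^'d \<Rightarrow> real"
  assumes fam: "M_family \<alpha> \<mu> S \<Theta> h w f p" and est: "jones_estimator \<alpha> \<mu> \<Theta> p n xs \<theta>"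
    and space: "space \<mu> = S" and "\<alpha> \<noteq> 1" "n \<ge> 1" and xs: "\<And>j. j \<in> {1..n} \<Longrightarrow> xs j \<in> S"
    and pos: "\<And>t x. t \<in> \<Theta> \<Longrightarrow> x \<in> S \<Longrightarrow> p t x > 0"
    and int_score: "integrable \<mu> (\<lambda>x. p \<theta> x powr \<alpha> *\<^sub>R score p \<theta> x)"
    and int_f: "integrable \<mu> (\<lambda>x. p \<theta> x *\<^sub>R f x)"
    and int_b: "integrable \<mu> (\<lambda>x. p \<theta> x * (h x + w \<theta> \<bullet> f x))"
  shows "(partial_deriv_vec r w \<theta> \<bullet> expect \<mu> (p \<theta>) f) / expect \<mu> (p \<theta>) (\<lambda>x. h x + w \<theta> \<bullet> f x) =
    (partial_deriv_vec r w \<theta> \<bullet> sample_mean n xs f) / (sample_mean n xs h + w \<theta> \<bullet> sample_mean n xs f)"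
proof -
  define c where "c = 1 / (\<alpha> - 1)"
  have c0: "c \<noteq> 0" and c: "c * (\<alpha> - 1) = 1" using \<open>\<alpha> \<noteq> 1\<close> by (auto simp: c_def)
  obtain Z :: "real^'k \<Rightarrow> real" where Z: "Z differentiable_on \<Theta>"
    and base: "\<And>t x. t \<in> \<Theta> \<Longrightarrow> x \<in> S \<Longrightarrow> 0 \<le> h x + w t \<bullet> f x"
    and pZ: "\<And>t x. t \<in> \<Theta> \<Longrightarrow> x \<in> S \<Longrightarrow> p t x = Z t * (h x + w t \<bullet> f x) powr c"
    using fam unfolding M_family_def c_def by blast
  have \<Theta>: "open \<Theta>" "\<theta> \<in> \<Theta>" and w: "\<And>i. (\<lambda>\<theta>. w \<theta> $ i) differentiable_on \<Theta>"
    and dens: "is_density \<mu> S (p \<theta>)"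
    and eq: "sample_mean n xs (\<lambda>x. p \<theta> x powr (\<alpha> - 1) *\<^sub>R score p \<theta> x)
         /\<^sub>R sample_mean n xs (\<lambda>x. p \<theta> x powr (\<alpha> - 1)) =
       (\<integral>x. p \<theta> x powr \<alpha> *\<^sub>R score p \<theta> x \<partial>\<mu>) /\<^sub>R (\<integral>x. p \<theta> x powr \<alpha> \<partial>\<mu>)"
    using fam est unfolding M_family_def jones_estimator_def by auto
  let ?v = "partial_deriv_vec r w \<theta>" and ?b = "\<lambda>x. h x + w \<theta> \<bullet> f x"
  define A where "A = partial_deriv r Z \<theta> / Z \<theta>"
  define k where "k = Z \<theta> powr (\<alpha> - 1)"
  have zero: "partial_deriv r (\<lambda>_. 0) \<theta> = 0"
    by (rule partial_deriv_eqI) simp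
  have facts: "0 < Z \<theta>" "0 < ?b x" "score p \<theta> x $ r = A + c * ((?v \<bullet> f x) / ?b x)"
    if x: "x \<in> S" for x
  proof -
    note D = power_family_derivs[where Z = Z and F = "\<lambda>_. 0" and h = h and f = f and c = c and p = p
        and x = x, OF \<Theta> w _ Z _ _ pos[OF \<Theta>(2) x]]
    show "0 < Z \<theta>" using D(1) pZ x base by simp
    show "0 < ?b x" using D(2) pZ x base by simp
    show "score p \<theta> x $ r = A + c * ((?v \<bullet> f x) / ?b x)"
      using D(3)[of r] pZ x zero base by (simp add: A_def)
  qed
  \<comment> \<open>The sign of \<open>Z \<theta>\<close> can only be read off at a point of
    \<open>S\<close>; the first sample point provides one because \<open>n \<ge> 1\<close>.\<close>
  have Z_pos: "0 < Z \<theta>" using facts(1)[OF xs[of 1]] \<open>n \<ge> 1\<close> by simp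
  then have k_pos: "0 < k" by (simp add: k_def)
  have p1: "p \<theta> x powr (\<alpha> - 1) = k * ?b x" if x: "x \<in> S" for x
    using facts(2)[OF x] Z_pos by (simp add: pZ[OF \<Theta>(2) x] powr_mult powr_powr c k_def)
  have p2: "p \<theta> x powr \<alpha> = k * (p \<theta> x * ?b x)" if x: "x \<in> S" for x
  proof -
    have "p \<theta> x powr \<alpha> = p \<theta> x * p \<theta> x powr (\<alpha> - 1)"
      using pos[OF \<Theta>(2) x] by (simp add: powr_diff)
    then show ?thesis using p1[OF x] by simp
  qed
  have s1: "p \<theta> x powr (\<alpha> - 1) * score p \<theta> x $ r = k * (A * ?b x + c * (?v \<bullet> f x))"
    if x: "x \<in> S" for x
    unfolding p1[OF x] facts(3)[OF x] using facts(2)[OF x] by (simp add: field_simps)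
  have s2: "p \<theta> x powr \<alpha> * score p \<theta> x $ r
      = k * (A * (p \<theta> x * ?b x) + c * (p \<theta> x * (?v \<bullet> f x)))" if x: "x \<in> S" for x
    unfolding p2[OF x] facts(3)[OF x] using facts(2)[OF x] by (simp add: field_simps)
  define m where "m = sample_mean n xs ?b"
  define e where "e = expect \<mu> (p \<theta>) ?b"
  have m_pos: "0 < m"
    unfolding m_def using facts(2) xs \<open>n \<ge> 1\<close> by (intro sample_mean_pos) auto
  have m_eq: "m = sample_mean n xs h + w \<theta> \<bullet> sample_mean n xs f"
    unfolding m_def by (simp only: sample_mean_add sample_mean_inner)
  \<comment> \<open>The base is positive on \<open>S\<close>, so the product can vanish only where
    the density does, and a density of mass one is not zero almost everywhere.\<close>
  have "\<not> (AE x in \<mu>. p \<theta> x * ?b x = 0)"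
  proof
    assume "AE x in \<mu>. p \<theta> x * ?b x = 0"
    then have "AE x in \<mu>. p \<theta> x = 0"
      using AE_space by eventually_elim (use facts(2) space in force)
    with is_density_AE_nonzero[OF dens] show False ..
  qed
  then have e_pos: "0 < e"
    unfolding e_def expect_def using int_b facts(2) pos[OF \<Theta>(2)] space
    by (auto intro!: integral_pos_of_AE mult_nonneg_nonneg less_imp_le)
  have "sample_mean n xs (\<lambda>x. p \<theta> x powr (\<alpha> - 1)) = sample_mean n xs (\<lambda>x. k * ?b x)"
    using p1 xs by (intro sample_mean_cong) simp
  then have M1: "sample_mean n xs (\<lambda>x. p \<theta> x powr (\<alpha> - 1)) = k * m"
    by (simp only: sample_mean_mult_left m_def)
  have "sample_mean n xs (\<lambda>x. p \<theta> x powr (\<alpha> - 1) *\<^sub>R score p \<theta> x) $ r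
      = sample_mean n xs (\<lambda>x. k * (A * ?b x + c * (?v \<bullet> f x)))"
    unfolding sample_mean_vec_nth using s1 xs by (intro sample_mean_cong) simp
  also have "\<dots> = k * (A * m + c * (?v \<bullet> sample_mean n xs f))"
    unfolding m_def
    \<comment> \<open>The first summand is fixed in \<open>sample_mean_add\<close> so that only the
      outer sum is split and the sum inside the base stays whole.\<close>
    by (simp only: sample_mean_mult_left sample_mean_inner sample_mean_add[of n xs "\<lambda>x. A * ?b x"])
  finally have M2: "sample_mean n xs (\<lambda>x. p \<theta> x powr (\<alpha> - 1) *\<^sub>R score p \<theta> x) $ r
      = k * (A * m + c * (?v \<bullet> sample_mean n xs f))" .
  have "(\<integral>x. p \<theta> x powr \<alpha> \<partial>\<mu>) = (\<integral>x. k * (p \<theta> x * ?b x) \<partial>\<mu>)"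
    using p2 space by (intro Bochner_Integration.integral_cong) auto
  then have E1: "(\<integral>x. p \<theta> x powr \<alpha> \<partial>\<mu>) = k * e"
    by (simp add: e_def expect_def)
  have "(\<integral>x. p \<theta> x powr \<alpha> *\<^sub>R score p \<theta> x \<partial>\<mu>) $ r
      = (\<integral>x. k * (A * (p \<theta> x * ?b x) + c * (p \<theta> x * (?v \<bullet> f x))) \<partial>\<mu>)"
    unfolding integral_vec_nth[OF int_score] using s2 space
    by (intro Bochner_Integration.integral_cong) auto
  also have "\<dots> = k * (A * e + c * (?v \<bullet> expect \<mu> (p \<theta>) f))"
    using int_b integral_inner_weighted[OF int_f, of ?v] by (simp add: e_def expect_def)
  finally have E2: "(\<integral>x. p \<theta> x powr \<alpha> *\<^sub>R score p \<theta> x \<partial>\<mu>) $ r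
      = k * (A * e + c * (?v \<bullet> expect \<mu> (p \<theta>) f))" .
  \<comment> \<open>This is the \<open>r\<close>-th component of the vector equation, with all four
    averages replaced by their closed forms.\<close>
  have "(k * (A * m + c * (?v \<bullet> sample_mean n xs f))) / (k * m)
      = (k * (A * e + c * (?v \<bullet> expect \<mu> (p \<theta>) f))) / (k * e)"
    using arg_cong[OF eq, of "\<lambda>v. v $ r"] by (simp add: M1 M2 E1 E2 divide_inverse_commute)
  then have "A + c * ((?v \<bullet> sample_mean n xs f) / m) = A + c * ((?v \<bullet> expect \<mu> (p \<theta>) f) / e)"
    using k_pos m_pos e_pos by (simp add: add_divide_distrib)
  then have "(?v \<bullet> sample_mean n xs f) / m = (?v \<bullet> expect \<mu> (p \<theta>) f) / e"
    using c0 by (simp only: add_left_cancel mult_cancel_left simp_thms)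
  then show ?thesis
    by (simp add: m_eq e_def)
qed

text \<open>Both quotients are shown to equal \<open>- A / c\<close>, where \<open>A\<close> is the
  logarithmic derivative of \<open>Z\<close>. The condition that the derivative of \<open>p\<close>
  integrates to 0 is the Hellinger equation with \<open>q\<close> replaced by
  \<open>p \<theta>\<close>, because \<open>p powr \<alpha> * p powr (1 - \<alpha>)\<close> is
  \<open>p\<close> and \<open>p\<close> times the score is the derivative of \<open>p\<close>. One
  computation therefore serves for both densities.\<close>

lemma hellinger_E_family:
  fixes w :: "real^'k::finite \<Rightarrow> real^'s" and p :: "real^'k \<Rightarrow> real^'d \<Rightarrow> real"
  assumes fam: "E_family \<alpha> \<mu> S \<Theta> h w f p" and est: "hellinger_estimator \<alpha> \<mu> \<Theta> p q \<theta>"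
    and deriv0: "has_bochner_integral \<mu> (\<lambda>x. partial_deriv r (\<lambda>t. p t x) \<theta>) 0"
    and space: "space \<mu> = S" and "\<alpha> \<noteq> 1"
    and q: "\<not> (AE x in \<mu>. q x = 0)"
    and pos: "\<And>t x. t \<in> \<Theta> \<Longrightarrow> x \<in> S \<Longrightarrow> p t x > 0"
    and int_score: "integrable \<mu> (\<lambda>x. (q x powr \<alpha> * p \<theta> x powr (1 - \<alpha>)) *\<^sub>R score p \<theta> x)"
    and int_pf: "integrable \<mu> (\<lambda>x. p \<theta> x powr \<alpha> *\<^sub>R f x)"
    and int_pb: "integrable \<mu> (\<lambda>x. p \<theta> x powr \<alpha> * (h x + w \<theta> \<bullet> f x))"
    and int_p: "integrable \<mu> (\<lambda>x. p \<theta> x powr \<alpha>)"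
    and int_q: "integrable \<mu> (\<lambda>x. q x powr \<alpha>)"
    and int_qf: "integrable \<mu> (\<lambda>x. q x powr \<alpha> *\<^sub>R f x)"
    and int_qh: "integrable \<mu> (\<lambda>x. q x powr \<alpha> * h x)"
  shows "(partial_deriv_vec r w \<theta> \<bullet> expect \<mu> (escort \<mu> \<alpha> (p \<theta>)) f)
        / expect \<mu> (escort \<mu> \<alpha> (p \<theta>)) (\<lambda>x. h x + w \<theta> \<bullet> f x) =
      (partial_deriv_vec r w \<theta> \<bullet> expect \<mu> (escort \<mu> \<alpha> q) f)
        / (expect \<mu> (escort \<mu> \<alpha> q) h + w \<theta> \<bullet> expect \<mu> (escort \<mu> \<alpha> q) f)"
proof -
  define c where "c = 1 / (1 - \<alpha>)"
  have c0: "c \<noteq> 0" and c: "c * (1 - \<alpha>) = 1" using \<open>\<alpha> \<noteq> 1\<close> by (auto simp: c_def)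
  obtain Z :: "real^'k \<Rightarrow> real" where Z: "Z differentiable_on \<Theta>"
    and base: "\<And>t x. t \<in> \<Theta> \<Longrightarrow> x \<in> S \<Longrightarrow> 0 \<le> h x + w t \<bullet> f x"
    and pZ: "\<And>t x. t \<in> \<Theta> \<Longrightarrow> x \<in> S \<Longrightarrow> p t x = Z t * (h x + w t \<bullet> f x) powr c"
    using fam unfolding E_family_def c_def by blast
  have \<Theta>: "open \<Theta>" "\<theta> \<in> \<Theta>" and w: "\<And>i. (\<lambda>\<theta>. w \<theta> $ i) differentiable_on \<Theta>"
    and dens: "is_density \<mu> S (p \<theta>)"
    and eq: "(\<integral>x. (q x powr \<alpha> * p \<theta> x powr (1 - \<alpha>)) *\<^sub>R score p \<theta> x \<partial>\<mu>) = 0"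
    using fam est unfolding E_family_def hellinger_estimator_def by auto
  let ?v = "partial_deriv_vec r w \<theta>" and ?b = "\<lambda>x. h x + w \<theta> \<bullet> f x"
  define A where "A = partial_deriv r Z \<theta> / Z \<theta>"
  define k where "k = Z \<theta> powr (1 - \<alpha>)"
  have zero: "partial_deriv r (\<lambda>_. 0) \<theta> = 0"
    by (rule partial_deriv_eqI) simp
  have facts: "0 < Z \<theta>" "0 < ?b x" "score p \<theta> x $ r = A + c * ((?v \<bullet> f x) / ?b x)"
      "partial_deriv r (\<lambda>t. p t x) \<theta> = p \<theta> x * score p \<theta> x $ r"
    if x: "x \<in> S" for x
  proof -
    note D = power_family_derivs[where Z = Z and F = "\<lambda>_. 0" and h = h and f = f and c = c and p = p
        and x = x, OF \<Theta> w _ Z _ _ pos[OF \<Theta>(2) x]]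
    show "0 < Z \<theta>" using D(1) pZ x base by simp
    show "0 < ?b x" using D(2) pZ x base by simp
    show "score p \<theta> x $ r = A + c * ((?v \<bullet> f x) / ?b x)"
      using D(3)[of r] pZ x zero base by (simp add: A_def)
    show "partial_deriv r (\<lambda>t. p t x) \<theta> = p \<theta> x * score p \<theta> x $ r"
      using D(4)[of r] pZ x base by simp
  qed
  \<comment> \<open>On an empty space every property holds almost everywhere, contradicting that
    \<open>p \<theta>\<close> is not almost everywhere zero. A point of \<open>S\<close> is wanted
    to read off the sign of \<open>Z \<theta>\<close>.\<close>
  have "S \<noteq> {}"
    using is_density_AE_nonzero[OF dens] space by (auto simp: eventually_ae_filter)
  then have Z_pos: "0 < Z \<theta>" using facts(1) by blast
  then have k_pos: "0 < k" by (simp add: k_def)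
  have p1: "p \<theta> x powr (1 - \<alpha>) = k * ?b x" if x: "x \<in> S" for x
    using facts(2)[OF x] Z_pos by (simp add: pZ[OF \<Theta>(2) x] powr_mult powr_powr c k_def)
  have p2: "p \<theta> x = k * (p \<theta> x powr \<alpha> * ?b x)" if x: "x \<in> S" for x
  proof -
    have "p \<theta> x = p \<theta> x powr \<alpha> * p \<theta> x powr (1 - \<alpha>)"
      using pos[OF \<Theta>(2) x] by (simp flip: powr_add)
    then show ?thesis unfolding p1[OF x] by (simp only: mult.left_commute)
  qed
  \<comment> \<open>Here \<open>u\<close> stands for \<open>q\<close> or \<open>p \<theta>\<close>,
    and \<open>vanish\<close> for the corresponding equation. The escort normalizer \<open>I\<close>
    occurs in numerator and denominator and cancels, so the equation can be solved for the
    quotient.\<close>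
  have ratio: "(?v \<bullet> expect \<mu> (escort \<mu> \<alpha> u) f) / expect \<mu> (escort \<mu> \<alpha> u) ?b = - A / c"
    if int: "integrable \<mu> (\<lambda>x. u x powr \<alpha> *\<^sub>R f x)" "integrable \<mu> (\<lambda>x. u x powr \<alpha> * ?b x)"
      "integrable \<mu> (\<lambda>x. u x powr \<alpha>)"
      and nz: "\<not> (AE x in \<mu>. u x = 0)"
      and vanish: "(\<integral>x. k * (A * (u x powr \<alpha> * ?b x) + c * (u x powr \<alpha> * (?v \<bullet> f x))) \<partial>\<mu>) = 0"
    for u
  proof -
    define I where "I = (\<integral>x. u x powr \<alpha> \<partial>\<mu>)"
    define e where "e = (\<integral>x. u x powr \<alpha> * ?b x \<partial>\<mu>)"
    \<comment> \<open>A \<open>powr\<close> value is nonnegative and is zero exactly when its base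
      is zero.\<close>
    have "0 < I"
      unfolding I_def using int(3) nz by (intro integral_pos_of_AE) auto
    have "\<not> (AE x in \<mu>. u x powr \<alpha> * ?b x = 0)"
    proof
      assume "AE x in \<mu>. u x powr \<alpha> * ?b x = 0"
      then have "AE x in \<mu>. u x = 0"
        using AE_space by eventually_elim (use facts(2) space in force)
      with nz show False ..
    qed
    then have "0 < e"
      unfolding e_def using int(2) facts(2) space
      by (intro integral_pos_of_AE) (auto intro!: mult_nonneg_nonneg simp: less_imp_le)
    have "k * (A * e + c * (?v \<bullet> (\<integral>x. u x powr \<alpha> *\<^sub>R f x \<partial>\<mu>))) = 0"
      using vanish int(2) integral_inner_weighted[OF int(1), of ?v] by (simp add: e_def)
    then have "A * e + c * (?v \<bullet> (\<integral>x. u x powr \<alpha> *\<^sub>R f x \<partial>\<mu>)) = 0"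
      using k_pos by (simp only: mult_eq_0_iff) simp
    then have "(?v \<bullet> (\<integral>x. u x powr \<alpha> *\<^sub>R f x \<partial>\<mu>)) / e = - A / c"
      using \<open>0 < e\<close> c0 by (simp add: field_simps)
    moreover have "expect \<mu> (escort \<mu> \<alpha> u) f = (1 / I) *\<^sub>R (\<integral>x. u x powr \<alpha> *\<^sub>R f x \<partial>\<mu>)"
      unfolding expect_def escort_def I_def[symmetric]
      by (subst integral_scaleR_right[symmetric]) (simp_all add: divide_inverse mult.commute)
    moreover have "expect \<mu> (escort \<mu> \<alpha> u) ?b = e / I"
      unfolding expect_def escort_def I_def[symmetric] e_def by simp
    ultimately show ?thesis
      using \<open>0 < I\<close> by simp
  qed
  have int_qb: "integrable \<mu> (\<lambda>x. q x powr \<alpha> * ?b x)"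
    using Bochner_Integration.integrable_add[OF int_qh integral_inner_weighted(1)[OF int_qf, of "w \<theta>"]]
    by (simp add: algebra_simps)
  \<comment> \<open>Replacing \<open>p \<theta> x powr (1 - \<alpha>)\<close> by
    \<open>k * ?b x\<close> clears the denominator of the score, which brings the Hellinger equation
    into the form \<open>vanish\<close>.\<close>
  have "(\<integral>x. k * (A * (q x powr \<alpha> * ?b x) + c * (q x powr \<alpha> * (?v \<bullet> f x))) \<partial>\<mu>)
      = (\<integral>x. (q x powr \<alpha> * p \<theta> x powr (1 - \<alpha>)) *\<^sub>R score p \<theta> x \<partial>\<mu>) $ r"
    unfolding integral_vec_nth[OF int_score]
  proof (intro Bochner_Integration.integral_cong refl)
    fix x assume "x \<in> space \<mu>"
    then have x: "x \<in> S" by (simp add: space)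
    show "k * (A * (q x powr \<alpha> * ?b x) + c * (q x powr \<alpha> * (?v \<bullet> f x))) =
        ((q x powr \<alpha> * p \<theta> x powr (1 - \<alpha>)) *\<^sub>R score p \<theta> x) $ r"
      unfolding vector_scaleR_component p1[OF x] facts(3)[OF x]
      using facts(2)[OF x] by (simp add: field_simps)
  qed
  then have Q: "(?v \<bullet> expect \<mu> (escort \<mu> \<alpha> q) f) / expect \<mu> (escort \<mu> \<alpha> q) ?b = - A / c"
    using eq by (intro ratio int_qf int_qb int_q q) simp
  \<comment> \<open>The same integrand with \<open>p \<theta>\<close> in place of \<open>q\<close>
    is the derivative of the density, whose integral is 0.\<close>
  have "(\<integral>x. k * (A * (p \<theta> x powr \<alpha> * ?b x) + c * (p \<theta> x powr \<alpha> * (?v \<bullet> f x))) \<partial>\<mu>)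
      = (\<integral>x. partial_deriv r (\<lambda>t. p t x) \<theta> \<partial>\<mu>)"
  proof (intro Bochner_Integration.integral_cong refl)
    fix x assume "x \<in> space \<mu>"
    then have x: "x \<in> S" by (simp add: space)
    have "partial_deriv r (\<lambda>t. p t x) \<theta> =
        (k * (p \<theta> x powr \<alpha> * ?b x)) * (A + c * ((?v \<bullet> f x) / ?b x))"
      using facts(3,4)[OF x] p2[OF x] by simp
    then show "k * (A * (p \<theta> x powr \<alpha> * ?b x) + c * (p \<theta> x powr \<alpha> * (?v \<bullet> f x))) =
        partial_deriv r (\<lambda>t. p t x) \<theta>"
      unfolding \<open>partial_deriv r (\<lambda>t. p t x) \<theta> = _\<close>
      using facts(2)[OF x] by (simp add: field_simps)
  qed
  then have "(?v \<bullet> expect \<mu> (escort \<mu> \<alpha> (p \<theta>)) f) / expect \<mu> (escort \<mu> \<alpha> (p \<theta>)) ?b = - A / c"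
    using deriv0 is_density_AE_nonzero[OF dens]
    by (intro ratio int_pf int_pb int_p) (simp_all add: has_bochner_integral_iff)
  moreover have "expect \<mu> (escort \<mu> \<alpha> q) ?b = expect \<mu> (escort \<mu> \<alpha> q) h + w \<theta> \<bullet> expect \<mu> (escort \<mu> \<alpha> q) f"
  proof -
    have h: "integrable \<mu> (\<lambda>x. escort \<mu> \<alpha> q x * h x)"
      and f: "integrable \<mu> (\<lambda>x. escort \<mu> \<alpha> q x *\<^sub>R f x)"
      using integrable_mult_right[OF int_qh, of "1 / (\<integral>y. q y powr \<alpha> \<partial>\<mu>)"]
        integrable_scaleR_right[OF int_qf, of "1 / (\<integral>y. q y powr \<alpha> \<partial>\<mu>)"]
      by (simp_all add: escort_def)
    show ?thesis
      using h integral_inner_weighted[OF f, of "w \<theta>"] by (simp add: expect_def distrib_left)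
  qed
  ultimately show ?thesis using Q by simp
qed

section \<open>Assembly of the three statements\<close>

theorem theorem10:
  fixes \<alpha> :: real and K :: setting and S :: "(real^'d) set" and \<mu> :: "(real^'d) measure"
    and \<Theta> :: "(real^'k) set"
    and h :: "real^'d \<Rightarrow> real" and f :: "real^'d \<Rightarrow> real^'s" and w :: "real^'k \<Rightarrow> real^'s"
    and p :: "real^'k \<Rightarrow> real^'d \<Rightarrow> real"
    and P :: "'o measure" and n :: nat and X :: "nat \<Rightarrow> 'o \<Rightarrow> real^'d"
    and \<omega> :: 'o and xs :: "nat \<Rightarrow> real^'d"
  defines "\<mu> \<equiv> ref_measure K S"
    and "xs \<equiv> (\<lambda>j. X j \<omega>)"
  assumes "\<alpha> > 0" and "\<alpha> \<noteq> 1"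
    and "K = Continuous \<Longrightarrow> S \<in> sets lebesgue"
    and "n \<ge> 1" and "iid P n X" and "\<omega> \<in> space P" and "\<forall>j\<in>{1..n}. xs j \<in> S"
    and support: "\<forall>\<theta>\<in>\<Theta>. {x. p \<theta> x > 0} = S"
  shows "(B_family \<alpha> \<mu> S \<Theta> h w f p \<longrightarrow>
      (\<forall>\<theta>. basu_estimator \<alpha> \<mu> \<Theta> p n xs \<theta> \<longrightarrow>
         integrable \<mu> (\<lambda>x. p \<theta> x powr \<alpha> *\<^sub>R score p \<theta> x) \<longrightarrow>
         integrable \<mu> (\<lambda>x. p \<theta> x *\<^sub>R f x) \<longrightarrow>
         (\<forall>r. partial_deriv_vec r w \<theta> \<bullet> expect \<mu> (p \<theta>) f =
              partial_deriv_vec r w \<theta> \<bullet> sample_mean n xs f)))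
    \<and> (M_family \<alpha> \<mu> S \<Theta> h w f p \<longrightarrow>
      (\<forall>\<theta>. jones_estimator \<alpha> \<mu> \<Theta> p n xs \<theta> \<longrightarrow>
         integrable \<mu> (\<lambda>x. p \<theta> x powr \<alpha> *\<^sub>R score p \<theta> x) \<longrightarrow>
         integrable \<mu> (\<lambda>x. p \<theta> x powr \<alpha>) \<longrightarrow>
         integrable \<mu> (\<lambda>x. p \<theta> x *\<^sub>R f x) \<longrightarrow>
         integrable \<mu> (\<lambda>x. p \<theta> x * (h x + w \<theta> \<bullet> f x)) \<longrightarrow>
         (\<forall>r. (partial_deriv_vec r w \<theta> \<bullet> expect \<mu> (p \<theta>) f)
                / expect \<mu> (p \<theta>) (\<lambda>x. h x + w \<theta> \<bullet> f x) =
              (partial_deriv_vec r w \<theta> \<bullet> sample_mean n xs f)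
                / (sample_mean n xs h + w \<theta> \<bullet> sample_mean n xs f))))
    \<and> (E_family \<alpha> \<mu> S \<Theta> h w f p \<longrightarrow>
      (\<forall>\<theta>\<in>\<Theta>. \<forall>r. has_bochner_integral \<mu> (\<lambda>x. partial_deriv r (\<lambda>t. p t x) \<theta>) 0) \<longrightarrow>
      (\<forall>q \<theta>. sample_estimate K S n xs q \<longrightarrow> hellinger_estimator \<alpha> \<mu> \<Theta> p q \<theta> \<longrightarrow>
         integrable \<mu> (\<lambda>x. (q x powr \<alpha> * p \<theta> x powr (1 - \<alpha>)) *\<^sub>R score p \<theta> x) \<longrightarrow>
         integrable \<mu> (\<lambda>x. p \<theta> x powr \<alpha>) \<longrightarrow>
         integrable \<mu> (\<lambda>x. p \<theta> x powr \<alpha> *\<^sub>R f x) \<longrightarrow>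
         integrable \<mu> (\<lambda>x. p \<theta> x powr \<alpha> * (h x + w \<theta> \<bullet> f x)) \<longrightarrow>
         integrable \<mu> (\<lambda>x. q x powr \<alpha>) \<longrightarrow>
         integrable \<mu> (\<lambda>x. q x powr \<alpha> *\<^sub>R f x) \<longrightarrow>
         integrable \<mu> (\<lambda>x. q x powr \<alpha> * h x) \<longrightarrow>
         (\<forall>r. (partial_deriv_vec r w \<theta> \<bullet> expect \<mu> (escort \<mu> \<alpha> (p \<theta>)) f)
                / expect \<mu> (escort \<mu> \<alpha> (p \<theta>)) (\<lambda>x. h x + w \<theta> \<bullet> f x) =
              (partial_deriv_vec r w \<theta> \<bullet> expect \<mu> (escort \<mu> \<alpha> q) f)
                / (expect \<mu> (escort \<mu> \<alpha> q) h
                     + w \<theta> \<bullet> expect \<mu> (escort \<mu> \<alpha> q) f))))"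
proof -
  note \<mu>_def = assms(1) and xs_def = assms(2)
  have space: "space \<mu> = S"
    by (cases K) (simp_all add: \<mu>_def)
  have pos: "p t x > 0" if "t \<in> \<Theta>" "x \<in> S" for t x
    using support that by blast
  have xs: "xs j \<in> S" if "j \<in> {1..n}" for j
    using assms that by blast
  \<comment> \<open>The only property of the estimate passed on to part (c), besides integrability
    and the estimating equation; it unifies the two settings.\<close>
  have est: "\<not> (AE x in \<mu>. q x = 0)" if "sample_estimate K S n xs q" for q
  proof (cases K)
    case Continuous
    then have "is_density \<mu> S q"
      using that by (simp add: \<mu>_def)
    then show ?thesis
      by (rule is_density_AE_nonzero)
  next
    case Discrete
    \<comment> \<open>Almost everywhere for counting measure means everywhere on \<open>S\<close>,
      so one point of \<open>S\<close> with positive empirical mass suffices; the first sample point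
      is one.\<close>
    have "empirical n xs (xs 1) \<noteq> 0"
      using \<open>n \<ge> 1\<close> by (auto simp: empirical_def intro!: exI[of _ 1])
    moreover have "\<mu> = count_space S"
      using Discrete by (simp add: \<mu>_def)
    ultimately show ?thesis
      using that Discrete xs[of 1] \<open>n \<ge> 1\<close> by (auto simp: AE_count_space)
  qed
  note facts = space \<open>\<alpha> \<noteq> 1\<close> \<open>n \<ge> 1\<close> xs pos
  show ?thesis
  proof (intro conjI impI allI, goal_cases)
    case (1 \<theta> r)
    then show ?case
      by - (rule basu_B_family, (assumption | rule facts)+)
  next
    case (2 \<theta> r)
    then show ?case
      by - (rule jones_M_family, (assumption | rule facts)+)
  next
    case (3 q \<theta> r)
    \<comment> \<open>The estimator lies in \<Theta> by definition, so the derivative condition can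
      be instantiated at it.\<close>
    then have "has_bochner_integral \<mu> (\<lambda>x. partial_deriv r (\<lambda>t. p t x) \<theta>) 0"
      by (simp add: hellinger_estimator_def)
    with 3 show ?case
      by - (rule hellinger_E_family, (assumption | rule facts est)+)
  qed
qed

end
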